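(* For $a<0$ let $u=u_{a,3}$ be the radially symmetric solution on $\mathbb{R}^6$ of $$\Delta^3 u=-e^{6u}\ \text{ in }\mathbb{R}^6,\qquad u(0)=u'(0)=u'''(0)=u'''''(0)=0,\qquad u''(0)=a,\qquad u''''(0)=3 .$$ Then $$\int_{\mathbb{R}^6} e^{6u_{a,3}}\,dx<\infty \ \text{ for } -a \text{ sufficiently large},\qquad\text{and}\qquad \lim_{a\to-\infty}\int_{\mathbb{R}^6}e^{6u_{a,3}}\,dx=\infty .$$ In particular, the conformal metric $g_{u_{a,3}}=e^{2u_{a,3}}|dx|^2$, which has constant $Q$-curvature $Q_{g_{u_{a,3}}}\equiv 1$, satisfies $\lim_{a\to-\infty}\mathrm{vol}(g_{u_{a,3}})=\infty$.
   Context: A radially symmetric function $f$ on $\mathbb{R}^6$ is regarded both as a function of $x\in\mathbb{R}^6$ (when writing $\Delta f$, $\Delta^2 f$, etc.) and as a function of $r=|x|\in[0,\infty)$ (when writing $f',f''$, etc.); so $\Delta f=f''+\frac{5}{r}f'$, and for smooth radial $f$ one has $\Delta f(0)=6f''(0)$ and $\Delta^2 f(0)=16 f''''(0)$. Thus the initial conditions $u''(0)=a$, $u''''(0)=3$ are equivalent to $\Delta u(0)=6a$, $\Delta^2u(0)=48$. The solution $u_{a,3}$ is the (unique, smooth) radial solution of this initial value problem; it exists for all $r\ge 0$. For $g_u=e^{2u}|dx|^2$ on $\mathbb{R}^6$, where $|dx|^2$ is the Euclidean metric, $Q_{g_u}=e^{-6u}(-\Delta)^3u$ and $\mathrm{vol}(g_u)=\int_{\mathbb{R}^6}e^{6u}\,dx$.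 *)

theory Defs
  imports "HOL-Analysis.Analysis"
begin

definition partial_deriv :: "'a::euclidean_space \<Rightarrow> ('a \<Rightarrow> real) \<Rightarrow> 'a \<Rightarrow> real" where
  "partial_deriv b f x = frechet_derivative f (at x) b"

fun C_diff :: "nat \<Rightarrow> ('a::euclidean_space \<Rightarrow> real) \<Rightarrow> bool" where
  "C_diff 0 f \<longleftrightarrow> continuous_on UNIV f"
| "C_diff (Suc k) f \<longleftrightarrow>
     (\<forall>x. f differentiable (at x)) \<and> (\<forall>b\<in>Basis. C_diff k (partial_deriv b f))"

definition smooth :: "('a::euclidean_space \<Rightarrow> real) \<Rightarrow> bool" where
  "smooth f \<longleftrightarrow> (\<forall>k. C_diff k f)"

definition laplacian :: "('a::euclidean_space \<Rightarrow> real) \<Rightarrow> 'a \<Rightarrow> real" where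
  "laplacian f x = (\<Sum>b\<in>Basis. partial_deriv b (partial_deriv b f) x)"

definition neg_laplacian :: "('a::euclidean_space \<Rightarrow> real) \<Rightarrow> 'a \<Rightarrow> real" where
  "neg_laplacian f x = - laplacian f x"

definition radial :: "('a::real_normed_vector \<Rightarrow> real) \<Rightarrow> bool" where
  "radial f \<longleftrightarrow> (\<forall>x y. norm x = norm y \<longrightarrow> f x = f y)"

text \<open>
  A radial function read as a function of \<open>r = |x|\<close>, by restricting it to a coordinate line.
  This extends the function of \<open>r \<ge> 0\<close> to an even function on the whole line, which is smooth
  if \<open>f\<close> is; hence the two-sided derivatives at \<open>0\<close> used below agree with the one-sided ones.
\<close>

definition profile :: "(real ^ 6 \<Rightarrow> real) \<Rightarrow> real \<Rightarrow> real" where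
  "profile f r = f (r *\<^sub>R axis 1 1)"

definition radial_solution :: "real \<Rightarrow> real \<Rightarrow> (real ^ 6 \<Rightarrow> real) \<Rightarrow> bool" where
  "radial_solution a b u \<longleftrightarrow>
     smooth u \<and> radial u \<and>
     (\<forall>x. (laplacian ^^ 3) u x = - exp (6 * u x)) \<and>
     profile u 0 = 0 \<and>
     (deriv ^^ 1) (profile u) 0 = 0 \<and>
     (deriv ^^ 2) (profile u) 0 = a \<and>
     (deriv ^^ 3) (profile u) 0 = 0 \<and>
     (deriv ^^ 4) (profile u) 0 = b \<and>
     (deriv ^^ 5) (profile u) 0 = 0"

text \<open>
  The conformal metric \<open>g\<^sub>u = e\<^bsup>2u\<^esup>|dx|\<^sup>2\<close> on \<open>\<real>\<^sup>6\<close> is represented by its conformal factor \<open>u\<close>;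
  the following are its Q-curvature and its total volume.
\<close>

definition Q_curvature :: "(real ^ 6 \<Rightarrow> real) \<Rightarrow> real ^ 6 \<Rightarrow> real" where
  "Q_curvature u x = exp (- 6 * u x) * (neg_laplacian ^^ 3) u x"

definition conformal_volume :: "(real ^ 6 \<Rightarrow> real) \<Rightarrow> ennreal" where
  "conformal_volume u = (\<integral>\<^sup>+ x. ennreal (exp (6 * u x)) \<partial>lborel)"

end

theory Submission imports Defs begin

text \<open>
  In radial coordinates \<open>u\<close>, \<open>\<Delta>u\<close>, \<open>\<Delta>\<^sup>2u\<close> form a chain of second-order equations
  \<open>(r\<^sup>5 f')' = r\<^sup>5 \<Delta>f\<close>, and \<open>mass r = - r\<^sup>5 (\<Delta>\<^sup>2u)'(r)\<close> is, up to the factor \<open>\<pi>\<^sup>3\<close>, the volume of the ball of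
  radius \<open>r\<close>. As \<open>\<Delta>\<^sup>2u\<close> decreases from \<open>48\<close>, \<open>u \<le> a r\<^sup>2/2 + r\<^sup>4/8\<close>, so hardly any mass lies in the ball of radius
  \<open>r\<^sub>0 = sqrt (-2a)\<close>; there \<open>\<Delta>\<^sup>2u \<ge> 47\<close> and hence \<open>\<Delta>u(r\<^sub>0) > 0\<close>.
  If \<open>\<Delta>\<^sup>2u\<close> stayed nonnegative, then \<open>\<Delta>u\<close> would stay above \<open>\<Delta>u(r\<^sub>0)\<close>, \<open>u\<close> would tend to \<open>\<infinity>\<close>, and the
  equation would drive \<open>\<Delta>\<^sup>2u\<close> to \<open>-\<infinity>\<close>. So \<open>\<Delta>\<^sup>2u\<close> becomes negative. This forces \<open>u \<le> - c r\<^sup>2\<close> near infinity,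
  giving finite volume; and it forces the mass to exceed \<open>16 a\<^sup>2\<close>, since a smaller mass could lower \<open>\<Delta>\<^sup>2u\<close> by
  at most \<open>1\<close> beyond \<open>r\<^sub>0\<close>.
\<close>

section \<open>The Laplacian of a radial function\<close>

lemma smooth_differentiable: "smooth f \<Longrightarrow> f differentiable (at x)"
  unfolding smooth_def by (metis C_diff.simps(2))

lemma smooth_partial_deriv: "smooth f \<Longrightarrow> b \<in> Basis \<Longrightarrow> smooth (partial_deriv b f)"
  unfolding smooth_def by (metis C_diff.simps(2))

lemma smooth_has_derivative:
  "smooth f \<Longrightarrow> (f has_derivative (\<lambda>h. partial_deriv h f x)) (at x)"
  using smooth_differentiable[of f x] unfolding partial_deriv_def
  by (simp add: frechet_derivative_works)

lemma partial_deriv_eqI: "(f has_derivative f') (at x) \<Longrightarrow> partial_deriv b f x = f' b"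
  by (simp add: partial_deriv_def frechet_derivative_at[symmetric])

lemma C_diff_const: "C_diff k (\<lambda>x. c)"
proof (induction k arbitrary: c)
  case (Suc k)
  have "partial_deriv b (\<lambda>x::'a. c) = (\<lambda>x. 0)" for b
    by (rule ext, rule partial_deriv_eqI) (rule has_derivative_const)
  with Suc show ?case by simp
qed simp

lemma C_diff_add: "C_diff k f \<Longrightarrow> C_diff k g \<Longrightarrow> C_diff k (\<lambda>x. f x + g x)"
proof (induction k arbitrary: f g)
  case 0
  then show ?case by (auto intro: continuous_on_add)
next
  case (Suc k)
  have "partial_deriv b (\<lambda>x. f x + g x) = (\<lambda>x. partial_deriv b f x + partial_deriv b g x)" for b
    using Suc.prems
    by (auto simp: fun_eq_iff partial_deriv_def frechet_derivative_works
        intro!: partial_deriv_eqI[unfolded partial_deriv_def] has_derivative_add)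
  with Suc show ?case by simp
qed

lemma partial_deriv_minus:
  assumes "f differentiable (at x)"
  shows "partial_deriv b (\<lambda>x. - f x) x = - partial_deriv b f x"
  using assms
  by (auto simp: partial_deriv_def frechet_derivative_works
      intro!: partial_deriv_eqI[unfolded partial_deriv_def] has_derivative_minus)

lemma C_diff_minus: "C_diff k f \<Longrightarrow> C_diff k (\<lambda>x. - f x)"
proof (induction k arbitrary: f)
  case 0
  then show ?case by (auto intro: continuous_on_minus)
next
  case (Suc k)
  have "partial_deriv b (\<lambda>x. - f x) = (\<lambda>x. - partial_deriv b f x)" for b
    using Suc.prems by (auto intro!: partial_deriv_minus)
  with Suc show ?case by simp
qed

lemma smooth_minus: "smooth f \<Longrightarrow> smooth (\<lambda>x. - f x)"
  by (simp add: smooth_def C_diff_minus)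

lemma smooth_sum:
  assumes "finite A" "\<And>i. i \<in> A \<Longrightarrow> smooth (f i)"
  shows "smooth (\<lambda>x. \<Sum>i\<in>A. f i x)"
  using assms
  by (induction rule: finite_induct) (auto simp: smooth_def C_diff_const C_diff_add)

lemma smooth_laplacian: "smooth f \<Longrightarrow> smooth (laplacian f)"
  using smooth_sum[of Basis "\<lambda>b. partial_deriv b (partial_deriv b f)"]
  by (simp add: smooth_partial_deriv laplacian_def[abs_def])

lemma laplacian_minus:
  assumes "smooth f"
  shows "laplacian (\<lambda>x. - f x) = (\<lambda>x. - laplacian f x)"
proof
  fix x
  have "partial_deriv b (\<lambda>x. - f x) = (\<lambda>x. - partial_deriv b f x)" for b
    by (rule ext, rule partial_deriv_minus) (rule smooth_differentiable[OF assms])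
  then show "laplacian (\<lambda>x. - f x) x = - laplacian f x"
    by (simp add: laplacian_def partial_deriv_minus smooth_differentiable smooth_partial_deriv
        assms sum_negf)
qed

section \<open>Radial functions along coordinate axes\<close>

lemma has_real_derivative_along_ray:
  assumes "smooth f"
  shows "((\<lambda>t. f (t *\<^sub>R b)) has_real_derivative partial_deriv b f (t *\<^sub>R b)) (at t)"
proof -
  have lin: "linear (\<lambda>h. partial_deriv h f (t *\<^sub>R b))"
    by (rule has_derivative_linear[OF smooth_has_derivative[OF assms]])
  have "((\<lambda>t. f (t *\<^sub>R b)) has_derivative (\<lambda>h. partial_deriv (h *\<^sub>R b) f (t *\<^sub>R b))) (at t)"
    by (rule has_derivative_compose[OF _ smooth_has_derivative[OF assms]])
      (auto intro!: derivative_eq_intros)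
  then show ?thesis
    by (simp add: has_field_derivative_def linear_scale[OF lin] mult_commute_abs)
qed

lemma radial_along_basis:
  assumes "radial f" "b \<in> Basis" "e \<in> Basis"
  shows "f (t *\<^sub>R b) = f (t *\<^sub>R e)"
  using assms by (simp add: radial_def)

lemma partial_deriv_radial_along_basis:
  assumes "smooth f" "radial f" "b \<in> Basis" "e \<in> Basis"
  shows "partial_deriv b f (t *\<^sub>R b) = partial_deriv e f (t *\<^sub>R e)"
  using has_real_derivative_along_ray[OF assms(1), of b t]
    has_real_derivative_along_ray[OF assms(1), of e t]
  by (simp add: radial_along_basis[OF assms(2-4)] DERIV_unique)

text \<open>Covers the point where the coefficient (n - 1) / |x| is singular: along every axis the
  first derivative is the same function of \<open>t\<close>, so all pure second derivatives agree at
  0.\<close>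

lemma laplacian_radial_0:
  fixes f :: "'a::euclidean_space \<Rightarrow> real"
  assumes "smooth f" "radial f" "e \<in> Basis"
  shows "laplacian f 0 = DIM('a) * partial_deriv e (partial_deriv e f) 0"
proof -
  have "partial_deriv b (partial_deriv b f) 0 = partial_deriv e (partial_deriv e f) 0"
    if "b \<in> Basis" for b
    using has_real_derivative_along_ray[OF smooth_partial_deriv[OF assms(1) that], of b 0]
      has_real_derivative_along_ray[OF smooth_partial_deriv[OF assms(1,3)], of e 0]
    by (simp add: partial_deriv_radial_along_basis[OF assms(1,2) that assms(3)] DERIV_unique)
  then show ?thesis by (simp add: laplacian_def)
qed

lemma has_derivative_norm_at:
  fixes x :: "'a::real_inner"
  shows "x \<noteq> 0 \<Longrightarrow> (norm has_derivative (\<lambda>h. x \<bullet> h / norm x)) (at x)"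
  using has_derivative_norm[of x]
  by (simp add: sgn_div_norm inner_commute divide_inverse mult.commute)

text \<open>Chain rule: \<open>f\<close> is its restriction to the axis \<open>e\<close> composed
  with the norm, whose gradient is x / |x|.\<close>

lemma partial_deriv_radial:
  fixes f :: "'a::euclidean_space \<Rightarrow> real"
  assumes "smooth f" "radial f" "e \<in> Basis" "x \<noteq> 0"
  shows "partial_deriv b f x = partial_deriv e f (norm x *\<^sub>R e) * (x \<bullet> b) / norm x"
proof -
  have eq: "(\<lambda>x. f (norm x *\<^sub>R e)) = f"
  proof
    fix y
    show "f (norm y *\<^sub>R e) = f y"
      using assms(2)[unfolded radial_def, rule_format, of "norm y *\<^sub>R e" y] assms(3) by simp
  qed
  have "((\<lambda>x. f (norm x *\<^sub>R e)) has_derivative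
      (\<lambda>h. partial_deriv e f (norm x *\<^sub>R e) * (x \<bullet> h / norm x))) (at x)"
    by (rule has_derivative_compose[OF has_derivative_norm_at[OF assms(4)], of "\<lambda>t. f (t *\<^sub>R e)"])
      (use has_real_derivative_along_ray[OF assms(1), of e "norm x"] in
        \<open>simp add: has_field_derivative_def\<close>)
  note this[unfolded eq]
  from partial_deriv_eqI[OF this, of b] show ?thesis by simp
qed

text \<open>Differentiate \<open>partial_deriv_radial\<close> once more and sum over the basis,
  where the squared coordinates add up to |x|^2; what remains is f'' + (n - 1) f' / r.\<close>

lemma laplacian_radial:
  fixes f :: "'a::euclidean_space \<Rightarrow> real"
  assumes f: "smooth f" "radial f" "e \<in> Basis" and x: "x \<noteq> 0"
  shows "laplacian f x = partial_deriv e (partial_deriv e f) (norm x *\<^sub>R e)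
    + (real DIM('a) - 1) / norm x * partial_deriv e f (norm x *\<^sub>R e)"
proof -
  define r where "r = norm x"
  define A where "A = partial_deriv e f (r *\<^sub>R e)"
  define B where "B = partial_deriv e (partial_deriv e f) (r *\<^sub>R e)"
  have r: "r > 0" using x by (simp add: r_def)
  have "partial_deriv b (partial_deriv b f) x
      = B * (x \<bullet> b)\<^sup>2 / r\<^sup>2 + A * (1 / r - (x \<bullet> b)\<^sup>2 / r^3)" if b: "b \<in> Basis" for b
  proof -
    note n = has_derivative_norm_at[OF x, folded r_def]
    have p: "((\<lambda>y. partial_deriv e f (norm y *\<^sub>R e)) has_derivative (\<lambda>h. B * (x \<bullet> h / r))) (at x)"
      by (rule has_derivative_compose[OF n, of "\<lambda>t. partial_deriv e f (t *\<^sub>R e)"])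
        (use has_real_derivative_along_ray[OF smooth_partial_deriv[OF f(1,3)], of e r] in
          \<open>simp add: has_field_derivative_def r_def B_def\<close>)
    have "((\<lambda>y. partial_deriv e f (norm y *\<^sub>R e) * (y \<bullet> b) / norm y) has_derivative
        (\<lambda>h. B * (x \<bullet> h / r) * (x \<bullet> b) / r + A * (h \<bullet> b) / r - A * (x \<bullet> b) * (x \<bullet> h / r) / r\<^sup>2)) (at x)"
      using r by (auto intro!: derivative_eq_intros p n simp: A_def r_def field_simps power2_eq_square)
    \<comment> \<open>The gradient formula holds only off the origin, hence the transfer on the open
      set \<open>- {0}\<close>.\<close>
    then have "(partial_deriv b f has_derivative
        (\<lambda>h. B * (x \<bullet> h / r) * (x \<bullet> b) / r + A * (h \<bullet> b) / r - A * (x \<bullet> b) * (x \<bullet> h / r) / r\<^sup>2)) (at x)"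
      by (rule has_derivative_transform_within_open[of _ _ _ _ "- {0}"])
        (use x in \<open>auto simp: partial_deriv_radial[OF f]\<close>)
    from partial_deriv_eqI[OF this, of b] have "partial_deriv b (partial_deriv b f) x
        = B * (x \<bullet> b / r) * (x \<bullet> b) / r + A / r - A * (x \<bullet> b) * (x \<bullet> b / r) / r\<^sup>2"
      using b by simp
    also have "\<dots> = B * (x \<bullet> b)\<^sup>2 / r\<^sup>2 + A * (1 / r - (x \<bullet> b)\<^sup>2 / r^3)"
      using r by (simp add: field_simps power2_eq_square power3_eq_cube)
    finally show ?thesis .
  qed
  then have "laplacian f x = (\<Sum>b\<in>Basis. B * (x \<bullet> b)\<^sup>2 / r\<^sup>2 + A * (1 / r - (x \<bullet> b)\<^sup>2 / r^3))"
    by (simp add: laplacian_def)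
  also have "\<dots> = (B / r\<^sup>2 - A / r^3) * (\<Sum>b\<in>Basis. (x \<bullet> b)\<^sup>2) + A * DIM('a) / r"
    by (simp add: sum.distrib sum_subtractf sum_distrib_left algebra_simps sum_divide_distrib)
  also have "(\<Sum>b\<in>Basis. (x \<bullet> b)\<^sup>2) = r\<^sup>2"
    unfolding r_def power2_norm_eq_inner by (subst euclidean_inner) (simp add: power2_eq_square)
  also have "(B / r\<^sup>2 - A / r^3) * r\<^sup>2 + A * DIM('a) / r = B + (real DIM('a) - 1) / r * A"
    using r by (simp add: field_simps power2_eq_square power3_eq_cube)
  finally show ?thesis by (simp add: A_def B_def r_def)
qed

lemma radial_laplacian:
  fixes f :: "'a::euclidean_space \<Rightarrow> real"
  assumes "smooth f" "radial f"
  shows "radial (laplacian f)"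
  unfolding radial_def
proof (intro allI impI)
  fix x y :: 'a
  assume n: "norm x = norm y"
  obtain e :: 'a where "e \<in> Basis" using nonempty_Basis by blast
  then show "laplacian f x = laplacian f y"
    using n laplacian_radial[OF assms, of e x] laplacian_radial[OF assms, of e y]
    by (cases "x = 0"; cases "y = 0") auto
qed

section \<open>Integration in polar coordinates\<close>

text \<open>Both measures give \<open>{..r}\<close> the volume of the closed ball of radius
  \<open>r\<close>, and these half-lines generate the Borel sets.\<close>

lemma distr_norm_lborel:
  "distr (lborel :: 'a::euclidean_space measure) borel norm =
    density lborel (\<lambda>r. ennreal (DIM('a) * unit_ball_vol DIM('a) * r ^ (DIM('a) - 1)) * indicator {0..} r)"
    (is "?M = density lborel ?d")
proof (rule measure_eqI_generator_eq[where E = "range (\<lambda>r::real. {..r})" and \<Omega> = UNIV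
      and A = "\<lambda>n. {..real n}"])
  show "Int_stable (range (\<lambda>r::real. {..r}))"
    by (auto simp: Int_stable_def)
  have emeasure_M: "emeasure ?M {..r} = (if r \<ge> 0 then ennreal (unit_ball_vol DIM('a) * r ^ DIM('a)) else 0)" for r
  proof -
    have "norm -` {..r} \<inter> space lborel = cball (0::'a) r" by auto
    then have "emeasure ?M {..r} = emeasure lborel (cball (0::'a) r)"
      by (simp add: emeasure_distr)
    then show ?thesis by (auto simp: emeasure_cball)
  qed
  show "emeasure ?M X = emeasure (density lborel ?d) X" if "X \<in> range (\<lambda>r::real. {..r})" for X
  proof -
    from that obtain r where X: "X = {..r}" by blast
    have "emeasure (density lborel ?d) X = (\<integral>\<^sup>+ x. ?d x * indicator {..r} x \<partial>lborel)"
      by (simp add: X emeasure_density)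
    also have "\<dots> = (\<integral>\<^sup>+ x. ennreal (DIM('a) * unit_ball_vol DIM('a) * x ^ (DIM('a) - 1)) * indicator {0..r} x \<partial>lborel)"
      by (intro nn_integral_cong) (auto split: split_indicator)
    also have "\<dots> = (if r \<ge> 0 then ennreal (unit_ball_vol DIM('a) * r ^ DIM('a)) else 0)"
    proof (cases "r \<ge> 0")
      case True
      have "((\<lambda>r. unit_ball_vol DIM('a) * r ^ DIM('a)) has_real_derivative
          DIM('a) * unit_ball_vol DIM('a) * x ^ (DIM('a) - 1)) (at x)" for x
        by (auto intro!: derivative_eq_intros)
      from nn_integral_FTC_Icc[OF _ this, of 0 r] True show ?thesis by simp
    qed simp
    finally show ?thesis by (simp add: X emeasure_M)
  qed
  show "emeasure ?M {..real n} \<noteq> \<infinity>" for n by (simp add: emeasure_M)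
  show "(\<Union>n. {..real n}) = UNIV" using real_arch_simple by auto
  have "sets (borel :: real measure) = sigma_sets UNIV (range (\<lambda>r. {..r}))"
    by (subst borel_eq_atMost) simp
  then show "sets ?M = sigma_sets UNIV (range (\<lambda>r::real. {..r}))"
    and "sets (density lborel ?d) = sigma_sets UNIV (range (\<lambda>r::real. {..r}))"
    by simp_all
qed auto

lemma nn_integral_radial:
  fixes f :: "real \<Rightarrow> ennreal"
  assumes [measurable]: "f \<in> borel_measurable borel"
  shows "(\<integral>\<^sup>+ x. f (norm (x :: 'a::euclidean_space)) \<partial>lborel) =
    (\<integral>\<^sup>+ r. ennreal (DIM('a) * unit_ball_vol DIM('a) * r ^ (DIM('a) - 1)) * indicator {0..} r * f r \<partial>lborel)"
proof -
  have "(\<integral>\<^sup>+ x. f (norm (x :: 'a)) \<partial>lborel) = (\<integral>\<^sup>+ r. f r \<partial>distr (lborel :: 'a measure) borel norm)"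
    by (rule nn_integral_distr[symmetric]) auto
  then show ?thesis
    by (simp add: distr_norm_lborel nn_integral_density)
qed

text \<open>Monotone convergence along the intervals [a, a + n]; the bound \<open>K\<close> stands
  in for a limit of \<open>F\<close> at infinity.\<close>

lemma nn_integral_atLeast_le:
  fixes f :: "real \<Rightarrow> real"
  assumes [measurable]: "f \<in> borel_measurable borel"
    and deriv: "\<And>x. x \<ge> a \<Longrightarrow> (F has_real_derivative f x) (at x)"
    and nonneg: "\<And>x. x \<ge> a \<Longrightarrow> f x \<ge> 0"
    and le: "\<And>x. x \<ge> a \<Longrightarrow> F x - F a \<le> K"
  shows "(\<integral>\<^sup>+ x. ennreal (f x) * indicator {a..} x \<partial>lborel) \<le> ennreal K"
proof -
  let ?M = "density lborel (\<lambda>x. ennreal (f x))"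
  have "{a..} = (\<Union>n. {a..a + real n})"
  proof -
    have "\<exists>n. x \<le> a + real n" for x using real_arch_simple[of "x - a"] by (auto simp: algebra_simps)
    then show ?thesis by auto
  qed
  then have "(\<integral>\<^sup>+ x. ennreal (f x) * indicator {a..} x \<partial>lborel) = emeasure ?M (\<Union>n. {a..a + real n})"
    by (simp add: emeasure_density flip: \<open>{a..} = _\<close>)
  also have "\<dots> = (SUP n. emeasure ?M {a..a + real n})"
    by (rule SUP_emeasure_incseq[symmetric]) (auto simp: incseq_def)
  also have "\<dots> \<le> ennreal K"
  proof (rule SUP_least)
    fix n
    have "emeasure ?M {a..a + real n} = ennreal (F (a + real n) - F a)"
      using nn_integral_FTC_Icc[of f a "a + real n" F] deriv nonneg by (simp add: emeasure_density)
    also have "\<dots> \<le> ennreal K" by (intro ennreal_leI le) simp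
    finally show "emeasure ?M {a..a + real n} \<le> ennreal K" .
  qed
  finally show ?thesis .
qed

section \<open>Analysis of the radial system\<close>

text \<open>\<open>g\<close> is the radial Laplacian of \<open>f\<close> in dimension 6, in divergence form, which avoids the singular
  coefficient at \<open>0\<close>.\<close>

definition radial_ode :: "(real \<Rightarrow> real) \<Rightarrow> (real \<Rightarrow> real) \<Rightarrow> (real \<Rightarrow> real) \<Rightarrow> bool" where
  "radial_ode f f' g \<longleftrightarrow> (\<forall>r\<ge>0. (f has_real_derivative f' r) (at r) \<and>
     ((\<lambda>r. r^5 * f' r) has_real_derivative r^5 * g r) (at r))"

lemma radial_odeD:
  assumes "radial_ode f f' g" "r \<ge> 0"
  shows "(f has_real_derivative f' r) (at r)"
    and "((\<lambda>r. r^5 * f' r) has_real_derivative r^5 * g r) (at r)"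
  using assms by (auto simp: radial_ode_def)

lemma radial_ode_minus:
  "radial_ode f f' g \<Longrightarrow> radial_ode (\<lambda>r. - f r) (\<lambda>r. - f' r) (\<lambda>r. - g r)"
  unfolding radial_ode_def by (auto intro!: DERIV_minus simp: minus_mult_right[symmetric])

lemma radial_ode_diff:
  "radial_ode f f' g \<Longrightarrow> radial_ode h h' k \<Longrightarrow>
    radial_ode (\<lambda>r. f r - h r) (\<lambda>r. f' r - h' r) (\<lambda>r. g r - k r)"
  unfolding radial_ode_def by (auto intro!: DERIV_diff simp: right_diff_distrib)

text \<open>Explicit comparison functions: in dimension 6 the Laplacians of r^2 and r^4 are 12 and
  32 r^2.\<close>

lemma radial_ode_poly:
  "radial_ode (\<lambda>r. A + B * r\<^sup>2 + C * r^4) (\<lambda>r. 2 * B * r + 4 * C * r^3) (\<lambda>r. 12 * B + 32 * C * r\<^sup>2)"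
  unfolding radial_ode_def
  by (auto intro!: derivative_eq_intros simp: algebra_simps eval_nat_numeral)

text \<open>The sign is required on the open interval only, because later derivative bounds are
  obtained by dividing by the radius, which excludes 0.\<close>

lemma DERIV_nonneg_interior_imp_le:
  fixes f :: "real \<Rightarrow> real"
  assumes "s \<le> t" "\<And>x. s \<le> x \<Longrightarrow> x \<le> t \<Longrightarrow> (f has_real_derivative f' x) (at x)"
    "\<And>x. s < x \<Longrightarrow> x < t \<Longrightarrow> f' x \<ge> 0"
  shows "f s \<le> f t"
proof (cases "s = t")
  case False
  with assms obtain z where "s < z" "z < t" "f t - f s = (t - s) * f' z"
    using MVT2[of s t f f'] by force
  with assms(1) assms(3) show ?thesis
    by (metis diff_ge_0_iff_ge mult_nonneg_nonneg)
qed simp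

text \<open>\<open>r^5 * f' r\<close> vanishes at 0 and does not decrease while \<open>g\<close> is
  nonnegative.\<close>

lemma radial_ode_nonneg_deriv:
  assumes "radial_ode f f' g" "\<And>r. 0 \<le> r \<Longrightarrow> r \<le> R \<Longrightarrow> g r \<ge> 0" "0 < r" "r \<le> R"
  shows "f' r \<ge> 0"
proof -
  define h where "h = (\<lambda>r. r^5 * f' r)"
  have "h 0 \<le> h r"
    by (rule DERIV_nonneg_interior_imp_le[where f = h and f' = "\<lambda>r. r^5 * g r"])
      (use assms radial_odeD(2)[OF assms(1)] in \<open>auto simp: h_def\<close>)
  with \<open>0 < r\<close> show ?thesis by (simp add: h_def zero_le_mult_iff)
qed

lemma radial_ode_mono:
  assumes "radial_ode f f' g" "\<And>r. 0 \<le> r \<Longrightarrow> r \<le> R \<Longrightarrow> g r \<ge> 0" "0 \<le> s" "s \<le> t" "t \<le> R"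
  shows "f s \<le> f t"
  by (rule DERIV_nonneg_interior_imp_le[where f = f and f' = f'])
    (use assms radial_odeD(1)[OF assms(1)] radial_ode_nonneg_deriv[OF assms(1,2)] in auto)

text \<open>Monotonicity of \<open>h - f\<close>, which starts nonnegative; the comparison principle
  behind the polynomial barriers below.\<close>

lemma radial_ode_compare:
  assumes "radial_ode f f' g" "radial_ode h h' k" "f 0 \<le> h 0"
    "\<And>r. 0 \<le> r \<Longrightarrow> r \<le> R \<Longrightarrow> g r \<le> k r" "0 \<le> r" "r \<le> R"
  shows "f r \<le> h r"
  using radial_ode_mono[OF radial_ode_diff[OF assms(2,1)], of R 0 r] assms by force

text \<open>Integrate twice from a late radius. Each constant of integration is absorbed by halving
  the leading coefficient: m / 6 to m / 12 for \<open>r^5 * f' r\<close>, then m / 24 to m / 48 for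
  \<open>f\<close>.\<close>

lemma radial_ode_growth:
  assumes ode: "radial_ode f f' g" and "m > 0" and g: "\<And>r. r \<ge> r0 \<Longrightarrow> g r \<ge> m"
  shows "\<exists>c>0. \<forall>\<^sub>F r in at_top. f r \<ge> c * r\<^sup>2"
proof -
  define s where "s = max r0 1"
  define K where "K = s^5 * f' s - m / 6 * s^6"
  \<comment> \<open>Beyond \<open>t\<close> the term \<open>m / 12 * r^6\<close> outweighs
    \<open>K\<close>, since r <= r^6 for r >= 1.\<close>
  define t where "t = max s (12 * \<bar>K\<bar> / m)"
  define K2 where "K2 = f t - m / 24 * t\<^sup>2"
  have s: "s \<ge> 1" "s \<ge> r0" and t: "t \<ge> s" "t \<ge> 12 * \<bar>K\<bar> / m" by (auto simp: s_def t_def)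
  have 1: "r^5 * f' r \<ge> K + m / 6 * r^6" if "r \<ge> s" for r
  proof -
    define h where "h = (\<lambda>r. r^5 * f' r - m / 6 * r^6)"
    have "h s \<le> h r"
    proof (rule DERIV_nonneg_interior_imp_le[where f = h and f' = "\<lambda>r. r^5 * g r - m * r^5"])
      fix x assume x: "s \<le> x"
      with s show "(h has_real_derivative x^5 * g x - m * x^5) (at x)"
        unfolding h_def
        by (intro DERIV_diff radial_odeD(2)[OF ode]) (auto intro!: derivative_eq_intros)
    next
      fix x assume x: "s < x"
      have "x^5 * (g x - m) \<ge> 0" using x s g[of x] by (intro mult_nonneg_nonneg) auto
      then show "x^5 * g x - m * x^5 \<ge> 0" by (simp add: algebra_simps)
    qed (use that in auto)
    then show ?thesis by (simp add: h_def K_def)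
  qed
  have 2: "f' r \<ge> m / 12 * r" if "r \<ge> t" for r
  proof -
    have r: "r \<ge> 1" "r \<ge> s" using that s t by auto
    have "12 * \<bar>K\<bar> / m \<le> r" using that t by simp
    also have "r \<le> r^6" using r by (simp add: self_le_power)
    finally have "m / 12 * r^6 \<ge> - K" using \<open>m > 0\<close> by (simp add: field_simps)
    with 1[OF r(2)] have "r^5 * f' r \<ge> m / 12 * r^6" by simp
    then have "r^5 * f' r \<ge> r^5 * (m / 12 * r)" by (simp add: algebra_simps eval_nat_numeral)
    with r show ?thesis by simp
  qed
  have 3: "f r \<ge> K2 + m / 24 * r\<^sup>2" if "r \<ge> t" for r
  proof -
    define h where "h = (\<lambda>r. f r - m / 24 * r\<^sup>2)"
    have "h t \<le> h r"
    proof (rule DERIV_nonneg_interior_imp_le[where f = h and f' = "\<lambda>r. f' r - m / 12 * r"])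
      fix x assume "t \<le> x"
      with s t show "(h has_real_derivative f' x - m / 12 * x) (at x)"
        unfolding h_def by (auto intro!: derivative_eq_intros radial_odeD(1)[OF ode])
    qed (use that 2 in auto)
    then show ?thesis by (simp add: h_def K2_def)
  qed
  have "f r \<ge> m / 48 * r\<^sup>2" if r: "r \<ge> max t (48 * \<bar>K2\<bar> / m)" for r
  proof -
    have "48 * \<bar>K2\<bar> / m \<le> r" using r by simp
    also have "r \<le> r\<^sup>2" using r s t by (simp add: self_le_power)
    finally have "m / 48 * r\<^sup>2 \<ge> - K2" using \<open>m > 0\<close> by (simp add: field_simps)
    with 3[of r] r show ?thesis by simp
  qed
  then have "\<forall>\<^sub>F r in at_top. f r \<ge> m / 48 * r\<^sup>2"
    unfolding eventually_at_top_linorder by blast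
  with \<open>m > 0\<close> show ?thesis by (intro exI[of _ "m / 48"]) simp
qed

text \<open>\<open>U\<close>, \<open>W\<close>, \<open>Z\<close> stand for u and its first two
  iterated Laplacians as functions of r, with \<open>U'\<close>, \<open>W'\<close>,
  \<open>Z'\<close> their derivatives; the values 6 a and 48 are 6 u''(0) and 16 u''''(0).\<close>

locale radial_system =
  fixes a :: real and U U' W W' Z Z' :: "real \<Rightarrow> real"
  assumes a_neg: "a < 0"
    and ode_U: "radial_ode U U' W"
    and ode_W: "radial_ode W W' Z"
    and ode_Z: "radial_ode Z Z' (\<lambda>r. - exp (6 * U r))"
    and U_0: "U 0 = 0" and W_0: "W 0 = 6 * a" and Z_0: "Z 0 = 48"
begin

definition mass :: "real \<Rightarrow> real" where
  "mass r = - (r^5 * Z' r)"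

lemma mass_deriv: "r \<ge> 0 \<Longrightarrow> (mass has_real_derivative r^5 * exp (6 * U r)) (at r)"
  using DERIV_minus[OF radial_odeD(2)[OF ode_Z, of r]] by (simp add: mass_def[abs_def])

lemma mass_mono: "0 \<le> s \<Longrightarrow> s \<le> t \<Longrightarrow> mass s \<le> mass t"
  by (rule DERIV_nonneg_interior_imp_le[where f = mass, OF _ mass_deriv]) auto

lemma mass_0: "mass 0 = 0"
  by (simp add: mass_def)

lemma Z_antimono: "0 \<le> s \<Longrightarrow> s \<le> t \<Longrightarrow> Z t \<le> Z s"
  using radial_ode_mono[OF radial_ode_minus[OF ode_Z], of t s t] by simp

text \<open>The barrier 6 a + 4 r^2 has Laplacian 48, the maximum of \<open>Z\<close>.\<close>

lemma W_le: "r \<ge> 0 \<Longrightarrow> W r \<le> 6 * a + 4 * r\<^sup>2"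
  using radial_ode_compare[OF ode_W radial_ode_poly[of "6 * a" 4 0], of r r] Z_antimono[of 0]
  by (simp add: W_0 Z_0)

text \<open>The barrier has Laplacian 6 a + 4 r^2, the bound of \<open>W_le\<close>.\<close>

lemma U_le: "r \<ge> 0 \<Longrightarrow> U r \<le> a / 2 * r\<^sup>2 + r^4 / 8"
  using radial_ode_compare[OF ode_U radial_ode_poly[of 0 "a / 2" "1 / 8"], of r r] W_le
  by (simp add: U_0)

text \<open>In this range the quartic term of \<open>U_le\<close> cancels at most half of the
  quadratic one, so 6 U <= - x^2 with x = sqrt (- a) r. The factor 1 / r keeps the resulting mass
  bound a monomial.\<close>

lemma exp_6U_le:
  assumes r: "r > 0" "r\<^sup>2 \<le> 2 * (- a)"
  shows "exp (6 * U r) \<le> 1 / (2 * sqrt (- a) * r)"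
proof -
  define x where "x = sqrt (- a) * r"
  have x: "x > 0" "x\<^sup>2 = - a * r\<^sup>2" using r a_neg by (auto simp: x_def power_mult_distrib)
  have "r^4 = r\<^sup>2 * r\<^sup>2" by (simp add: eval_nat_numeral)
  also have "\<dots> \<le> 2 * (- a) * r\<^sup>2" by (rule mult_right_mono[OF r(2)]) simp
  finally have "6 * U r \<le> 3 / 2 * (a * r\<^sup>2)" using U_le[of r] r(1) by simp
  also have "\<dots> \<le> - (x\<^sup>2)" using x a_neg by (simp add: mult_nonpos_nonneg)
  finally have "exp (6 * U r) \<le> exp (- (x\<^sup>2))" by simp
  also have "\<dots> = 1 / exp (x\<^sup>2)" by (simp add: exp_minus divide_inverse)
  also have "\<dots> \<le> 1 / (2 * x)"
  proof (rule divide_left_mono)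
    have "2 * x \<le> 1 + x\<^sup>2" using sum_squares_bound[of x 1] by simp
    also have "\<dots> \<le> exp (x\<^sup>2)" by (rule exp_ge_add_one_self)
    finally show "2 * x \<le> exp (x\<^sup>2)" .
  qed (use x in auto)
  finally show ?thesis by (simp add: x_def mult.assoc)
qed

text \<open>The square - 2 a lies between the zero - 3 a / 2 of the barrier for \<open>W\<close> and
  the zero - 4 a of the one for \<open>U\<close>: far enough out for \<open>W\<close> to turn
  positive, near enough for \<open>U\<close> to stay very negative.\<close>

definition r\<^sub>0 :: real where
  "r\<^sub>0 = sqrt (2 * (- a))"

lemma r0: "r\<^sub>0 > 0" "r\<^sub>0\<^sup>2 = 2 * (- a)"
  using a_neg by (auto simp: r\<^sub>0_def)

text \<open>By \<open>exp_6U_le\<close> the mass density is at most r^4 / (2 sqrt (- a)); integrate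
  from 0.\<close>

lemma mass_le:
  assumes "0 \<le> r" "r \<le> r\<^sub>0"
  shows "mass r \<le> r^5 / (10 * sqrt (- a))"
proof -
  define h where "h = (\<lambda>r. r^5 / (10 * sqrt (- a)) - mass r)"
  have "h 0 \<le> h r"
  proof (rule DERIV_nonneg_interior_imp_le[where f = h and f' = "\<lambda>r. r^4 / (2 * sqrt (- a)) - r^5 * exp (6 * U r)"])
    fix x :: real assume "0 \<le> x"
    then show "(h has_real_derivative
        x^4 / (2 * sqrt (- a)) - x^5 * exp (6 * U x)) (at x)"
      unfolding h_def using a_neg by (auto intro!: derivative_eq_intros mass_deriv simp: field_simps)
  next
    fix x assume x: "0 < x" "x < r"
    have "x\<^sup>2 \<le> r\<^sub>0\<^sup>2" by (rule power_mono) (use x assms in auto)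
    then have "x^5 * exp (6 * U x) \<le> x^5 * (1 / (2 * sqrt (- a) * x))"
      using x r0 by (intro mult_left_mono exp_6U_le) auto
    also have "\<dots> = x^4 / (2 * sqrt (- a))" using x by (simp add: eval_nat_numeral)
    finally show "x^4 / (2 * sqrt (- a)) - x^5 * exp (6 * U x) \<ge> 0" by simp
  qed (use assms in auto)
  then show ?thesis by (simp add: h_def mass_0)
qed

text \<open>By \<open>mass_le\<close>, \<open>Z\<close> falls at rate at most 1 / (10 sqrt (- a))
  over a length of at most sqrt 2 sqrt (- a), so it loses less than 1, whatever \<open>a\<close>
  is.\<close>

lemma Z_ge:
  assumes "0 \<le> r" "r \<le> r\<^sub>0"
  shows "Z r \<ge> 47"
proof -
  define q where "q = 10 * sqrt (- a)"
  have q: "q > 0" using a_neg by (simp add: q_def)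
  define h where "h = (\<lambda>r. Z r + r / q)"
  have "h 0 \<le> h r"
  proof (rule DERIV_nonneg_interior_imp_le[where f = h and f' = "\<lambda>r. Z' r + 1 / q"])
    fix x :: real assume "0 \<le> x"
    then show "(h has_real_derivative Z' x + 1 / q) (at x)"
      unfolding h_def using q by (auto intro!: derivative_eq_intros radial_odeD(1)[OF ode_Z])
  next
    fix x assume x: "0 < x" "x < r"
    have "x^5 * (- Z' x) \<le> x^5 * (1 / q)"
      using mass_le[of x] x assms by (simp add: mass_def q_def)
    then have "- Z' x \<le> 1 / q" by (rule mult_left_le_imp_le) (use x in auto)
    then show "Z' x + 1 / q \<ge> 0" by simp
  qed (use assms in auto)
  moreover have "r / q \<le> 1"
  proof -
    have "r\<^sub>0 = sqrt 2 * sqrt (- a)" by (simp add: r\<^sub>0_def real_sqrt_mult[symmetric])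
    also have "\<dots> \<le> 10 * sqrt (- a)" by (rule mult_right_mono) (use a_neg in \<open>auto intro: real_le_lsqrt\<close>)
    finally have "r \<le> q" using assms by (simp add: q_def)
    with q show ?thesis by simp
  qed
  ultimately show ?thesis by (simp add: h_def Z_0)
qed

text \<open>The lower barrier 6 a + 47 r^2 / 12 has Laplacian 47 and takes the value - 11 a / 6 at
  \<open>r\<^sub>0\<close>.\<close>

lemma W_r0_pos: "W r\<^sub>0 > 0"
proof -
  have "6 * a + 47 / 12 * r\<^sub>0\<^sup>2 \<le> W r\<^sub>0"
    using radial_ode_compare[OF radial_ode_poly[of "6 * a" "47 / 12" 0] ode_W, of r\<^sub>0 r\<^sub>0] Z_ge r0
    by (simp add: W_0)
  with r0(2) a_neg show ?thesis by simp
qed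

section \<open>Sign change of \<open>Z\<close> and its consequences for the mass\<close>

lemma Z_becomes_negative: "\<exists>r\<ge>0. Z r < 0"
proof (rule ccontr)
  assume "\<not> ?thesis"
  then have Z: "Z r \<ge> 0" if "r \<ge> 0" for r using that by force
  have "W r \<ge> W r\<^sub>0" if "r \<ge> r\<^sub>0" for r
    using radial_ode_mono[OF ode_W, of r r\<^sub>0 r] Z r0 that by simp
  then obtain c where c: "c > 0" "\<forall>\<^sub>F r in at_top. c * r\<^sup>2 \<le> U r"
    using radial_ode_growth[OF ode_U W_r0_pos] by blast
  have "\<forall>\<^sub>F r in at_top. exp (6 * U r) \<ge> 1"
    using c(2)
  proof eventually_elim
    case (elim r)
    have "0 \<le> c * r\<^sup>2" using c(1) by simp
    with elim show ?case by simp
  qed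
  \<comment> \<open>The double negation matches the Laplacian of \<open>- Z\<close> as
    \<open>radial_ode_minus\<close> produces it.\<close>
  then obtain R where R: "\<And>r. r \<ge> R \<Longrightarrow> 1 \<le> - (- exp (6 * U r))"
    by (auto simp: eventually_at_top_linorder)
  obtain d where d: "d > 0" "\<forall>\<^sub>F r in at_top. d * r\<^sup>2 \<le> - Z r"
    using radial_ode_growth[OF radial_ode_minus[OF ode_Z] zero_less_one R] by blast
  have "\<forall>\<^sub>F r in at_top. r > (0::real)" by (rule eventually_gt_at_top)
  with d(2) have "\<forall>\<^sub>F r :: real in at_top. False"
  proof eventually_elim
    case (elim r)
    have "0 < d * r\<^sup>2" using d(1) elim by simp
    with elim Z[of r] show ?case by simp
  qed
  then show False by simp
qed

text \<open>Once negative, \<open>Z\<close> stays below a negative constant by monotonicity; the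
  growth lemma then applies to \<open>- W\<close> and, with the constant lower bound this yields, to
  \<open>- U\<close>.\<close>

lemma U_tends_to_minus_infinity: "\<exists>c>0. \<forall>\<^sub>F r in at_top. c * r\<^sup>2 \<le> - U r"
proof -
  obtain r1 where r1: "r1 \<ge> 0" "Z r1 < 0" using Z_becomes_negative by blast
  have "- Z r1 \<le> - Z r" if "r \<ge> r1" for r using Z_antimono[of r1 r] r1 that by simp
  then obtain c where c: "c > 0" "\<forall>\<^sub>F r in at_top. c * r\<^sup>2 \<le> - W r"
    using radial_ode_growth[OF radial_ode_minus[OF ode_W], of "- Z r1" r1] r1 by force
  have "\<forall>\<^sub>F r in at_top. r \<ge> (1::real)" by (rule eventually_ge_at_top)
  with c(2) have "\<forall>\<^sub>F r in at_top. c \<le> - W r"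
  proof eventually_elim
    case (elim r)
    have "c * 1 \<le> c * r\<^sup>2" using c(1) elim by (intro mult_left_mono) auto
    with elim show ?case by simp
  qed
  then obtain R where "\<And>r. r \<ge> R \<Longrightarrow> c \<le> - W r" by (auto simp: eventually_at_top_linorder)
  from radial_ode_growth[OF radial_ode_minus[OF ode_U] c(1) this] show ?thesis .
qed

text \<open>Gaussian decay of exp (6 U) beats r^5; the integrable majorant D / r^3 suffices.\<close>

lemma mass_bounded: "\<exists>K. \<forall>r\<ge>0. mass r \<le> K"
proof -
  obtain c where c: "c > 0" "\<forall>\<^sub>F r in at_top. c * r\<^sup>2 \<le> - U r"
    using U_tends_to_minus_infinity by blast
  then obtain R where R: "\<And>r. r \<ge> R \<Longrightarrow> c * r\<^sup>2 \<le> - U r" by (auto simp: eventually_at_top_linorder)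
  define s where "s = max R 1"
  \<comment> \<open>From exp y >= (y / 4)^4 = y^4 / 256 with y = 6 c x^2: the eighth power of x
    gained turns x^5 into x^(-3).\<close>
  define D where "D = 256 / (6 * c)^4"
  have s: "s \<ge> 1" "s \<ge> R" by (auto simp: s_def)
  have D: "D > 0" using c by (simp add: D_def)
  have dens: "x^5 * exp (6 * U x) \<le> D / x^3" if x: "x \<ge> s" for x
  proof -
    define y where "y = 6 * c * x\<^sup>2"
    have x0: "x > 0" and y: "y > 0" using x s c by (auto simp: y_def)
    have "exp (6 * U x) \<le> exp (- y)" using R[of x] x s by (simp add: y_def)
    also have "\<dots> = 1 / exp y" by (simp add: exp_minus divide_inverse)
    also have "\<dots> \<le> 1 / (y^4 / 256)"
    proof (rule divide_left_mono)
      have "(y / 4)^4 \<le> exp (y / 4)^4"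
        using exp_ge_add_one_self[of "y / 4"] y by (intro power_mono) linarith+
      also have "\<dots> = exp y" using exp_of_nat_mult[of 4 "y / 4"] by simp
      finally show "y^4 / 256 \<le> exp y" by (simp add: power_divide)
    qed (use y in auto)
    finally have "x^5 * exp (6 * U x) \<le> x^5 * (1 / (y^4 / 256))"
      using x0 by (intro mult_left_mono) auto
    also have "\<dots> = D / x^3"
      using x0 c(1) by (simp add: y_def D_def field_simps eval_nat_numeral)
    finally show ?thesis .
  qed
  have "mass r \<le> mass s + D / 2" if r: "r \<ge> s" for r
  proof -
    define h where "h = (\<lambda>r. - D / 2 / r\<^sup>2 - mass r)"
    have "h s \<le> h r"
    proof (rule DERIV_nonneg_interior_imp_le[where f = h and f' = "\<lambda>r. D / r^3 - r^5 * exp (6 * U r)"])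
      fix x assume "s \<le> x"
      with s show "(h has_real_derivative D / x^3 - x^5 * exp (6 * U x)) (at x)"
        unfolding h_def by (auto intro!: derivative_eq_intros mass_deriv simp: field_simps eval_nat_numeral)
    next
      fix x assume "s < x"
      with dens[of x] show "D / x^3 - x^5 * exp (6 * U x) \<ge> 0" by simp
    qed (use r in auto)
    moreover have "D / 2 / s\<^sup>2 \<le> D / 2" using D s by (simp add: field_simps)
    moreover have "D / 2 / r\<^sup>2 \<ge> 0" using D by simp
    ultimately show ?thesis by (simp add: h_def)
  qed
  moreover have "mass r \<le> mass s" if "0 \<le> r" "r \<le> s" for r using that by (rule mass_mono)
  ultimately have "\<forall>r\<ge>0. mass r \<le> mass s + D / 2" using D by (smt (verit) half_gt_zero_iff)
  then show ?thesis ..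
qed

text \<open>The constant 16 a^2 is tuned to \<open>r\<^sub>0\<close>: a mass below it makes
  \<open>Z\<close> fall beyond \<open>r\<^sub>0\<close> by at most the integral of 16 a^2 / r^5,
  which is 4 a^2 / \<open>r\<^sub>0^4\<close> = 1. Then \<open>Z\<close> would never become
  negative.\<close>

lemma mass_becomes_large: "\<exists>r\<ge>0. mass r > 16 * a\<^sup>2"
proof (rule ccontr)
  assume "\<not> ?thesis"
  then have M: "mass r \<le> 16 * a\<^sup>2" if "r \<ge> 0" for r using that by force
  have "Z r \<ge> 46" if r: "r \<ge> r\<^sub>0" for r
  proof -
    define h where "h = (\<lambda>r. Z r - 4 * a\<^sup>2 / r^4)"
    have "h r\<^sub>0 \<le> h r"
    proof (rule DERIV_nonneg_interior_imp_le[where f = h and f' = "\<lambda>r. Z' r + 16 * a\<^sup>2 / r^5"])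
      fix x assume "r\<^sub>0 \<le> x"
      with r0 show "(h has_real_derivative Z' x + 16 * a\<^sup>2 / x^5) (at x)"
        unfolding h_def by (auto intro!: derivative_eq_intros radial_odeD(1)[OF ode_Z] simp: field_simps eval_nat_numeral)
    next
      fix x assume "r\<^sub>0 < x"
      with r0 have x: "x > 0" by simp
      have "0 \<le> x^5 * Z' x + 16 * a\<^sup>2" using M[of x] x by (simp add: mass_def)
      also have "\<dots> = x^5 * (Z' x + 16 * a\<^sup>2 / x^5)" using x by (simp add: field_simps)
      finally show "Z' x + 16 * a\<^sup>2 / x^5 \<ge> 0" using x by (simp add: zero_le_mult_iff)
    qed (use r in auto)
    moreover have "4 * a\<^sup>2 / r\<^sub>0^4 = 1"
    proof -
      have "r\<^sub>0^4 = (r\<^sub>0\<^sup>2)\<^sup>2" by simp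
      also have "\<dots> = 4 * a\<^sup>2" by (simp only: r0(2)) (simp add: power_mult_distrib)
      finally show ?thesis using a_neg by simp
    qed
    moreover have "4 * a\<^sup>2 / r^4 \<ge> 0" by simp
    ultimately show ?thesis using Z_ge[of r\<^sub>0] r0(1) unfolding h_def by linarith
  qed
  moreover have "Z r \<ge> 46" if "0 \<le> r" "r \<le> r\<^sub>0" for r using Z_ge[OF that] by simp
  ultimately have "Z r \<ge> 0" if "r \<ge> 0" for r using that by (meson linear order_trans zero_le_numeral)
  with Z_becomes_negative show False by force
qed

end

section \<open>Profiles of radial solutions\<close>

text \<open>On the axis to which \<open>profile\<close> restricts, this is the derivative in
  r.\<close>

abbreviation (input) D1 :: "(real ^ 6 \<Rightarrow> real) \<Rightarrow> real ^ 6 \<Rightarrow> real" where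
  "D1 \<equiv> partial_deriv (axis 1 1)"

lemma axis_1_Basis: "axis 1 1 \<in> (Basis :: (real ^ 6) set)"
  by (simp add: axis_in_Basis_iff)

lemma smooth_D1: "smooth f \<Longrightarrow> smooth (D1 f)"
  by (rule smooth_partial_deriv[OF _ axis_1_Basis])

lemma profile_has_derivative:
  "smooth f \<Longrightarrow> (profile f has_real_derivative profile (D1 f) r) (at r)"
  using has_real_derivative_along_ray[of f "axis 1 1" r] by (simp add: profile_def[abs_def])

lemma profile_measurable: "smooth f \<Longrightarrow> profile f \<in> borel_measurable borel"
  by (intro borel_measurable_continuous_onI DERIV_continuous_on[OF profile_has_derivative])

lemma deriv_profile: "smooth f \<Longrightarrow> (deriv ^^ n) (profile f) = profile ((D1 ^^ n) f)"
proof (induction n)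
  case (Suc n)
  have "smooth ((D1 ^^ n) f)" by (induction n) (use Suc.prems smooth_D1 in auto)
  then have "deriv (profile ((D1 ^^ n) f)) = profile (D1 ((D1 ^^ n) f))"
    by (intro ext DERIV_imp_deriv profile_has_derivative)
  with Suc show ?case by simp
qed simp

text \<open>The sign \<open>s\<close> treats even (1) and odd (-1) functions together.\<close>

lemma DERIV_reflect:
  fixes f :: "real \<Rightarrow> real"
  assumes "\<And>r. (f has_real_derivative f' r) (at r)" "\<And>r. f (- r) = s * f r"
  shows "f' (- r) = - s * f' r"
proof -
  have "((\<lambda>r. f (- r)) has_real_derivative - f' (- r)) (at r)"
    using DERIV_mirror[of f "f' (- r)" r] assms(1)[of "- r"] by simp
  moreover have "((\<lambda>r. f (- r)) has_real_derivative s * f' r) (at r)"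
    unfolding assms(2) by (intro DERIV_cmult assms(1))
  ultimately show ?thesis using DERIV_unique by fastforce
qed

context
  fixes f :: "real ^ 6 \<Rightarrow> real"
  assumes f: "smooth f" "radial f"
begin

lemma profile_even: "profile f (- r) = profile f r"
  using f(2) by (simp add: radial_def profile_def)

lemma profile_D1_odd: "profile (D1 f) (- r) = - profile (D1 f) r"
  using DERIV_reflect[OF profile_has_derivative[OF f(1)], of 1] profile_even by simp

lemma profile_D1_D1_even: "profile (D1 (D1 f)) (- r) = profile (D1 (D1 f)) r"
  using DERIV_reflect[OF profile_has_derivative[OF smooth_D1[OF f(1)]], of "-1"] profile_D1_odd
  by simp

text \<open>Multiplied by r, the identity holds on the whole line and can be differentiated at 0;
  parity handles negative r, where the norm is - r.\<close>

lemma profile_laplacian: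
  "r * profile (laplacian f) r = r * profile (D1 (D1 f)) r + 5 * profile (D1 f) r"
proof (cases r "0 :: real" rule: linorder_cases)
  case greater
  with laplacian_radial[OF f axis_1_Basis, of "r *\<^sub>R axis 1 1"] show ?thesis
    by (simp add: profile_def field_simps)
next
  case less
  with laplacian_radial[OF f axis_1_Basis, of "r *\<^sub>R axis 1 1"] show ?thesis
    using profile_D1_odd[of r] profile_D1_D1_even[of r]
    by (simp add: profile_def field_simps)
next
  case equal
  with profile_D1_odd[of 0] show ?thesis by simp
qed

lemma profile_radial_ode: "radial_ode (profile f) (profile (D1 f)) (profile (laplacian f))"
  unfolding radial_ode_def
proof (intro allI impI conjI)
  fix r :: real
  show "(profile f has_real_derivative profile (D1 f) r) (at r)"
    by (rule profile_has_derivative[OF f(1)])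
  have "r^5 * profile (laplacian f) r = r^4 * (r * profile (D1 (D1 f)) r + 5 * profile (D1 f) r)"
    unfolding profile_laplacian[symmetric] by (simp add: eval_nat_numeral)
  then have "r^5 * profile (laplacian f) r = 5 * r^4 * profile (D1 f) r + profile (D1 (D1 f)) r * r^5"
    by (simp add: algebra_simps eval_nat_numeral)
  then show "((\<lambda>r. r^5 * profile (D1 f) r) has_real_derivative r^5 * profile (laplacian f) r) (at r)"
    by (auto intro!: derivative_eq_intros profile_has_derivative smooth_D1 f)
qed

lemma profile_laplacian_0: "profile (laplacian f) 0 = 6 * profile ((D1 ^^ 2) f) 0"
  using laplacian_radial_0[OF f axis_1_Basis] by (simp add: profile_def eval_nat_numeral)

text \<open>Differentiating \<open>r \<Delta>f = r f'' + 5 f'\<close> three times at \<open>0\<close> gives \<open>3 (\<Delta>f)'' = 8 f''''\<close>.\<close>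

lemma profile_bilaplacian_0: "profile (laplacian (laplacian f)) 0 = 16 * profile ((D1 ^^ 4) f) 0"
proof -
  define F where "F n = profile ((D1 ^^ n) f)" for n
  define G where "G n = profile ((D1 ^^ n) (laplacian f))" for n
  have "smooth ((D1 ^^ n) f)" "smooth ((D1 ^^ n) (laplacian f))" for n
    by (induction n) (use f smooth_D1 smooth_laplacian in auto)
  then have dF: "(F n has_real_derivative F (Suc n) r) (at r)"
    and dG: "(G n has_real_derivative G (Suc n) r) (at r)" for n r
    unfolding F_def G_def using profile_has_derivative by auto
  have eq0: "(\<lambda>r. r * G 0 r) = (\<lambda>r. r * F 2 r + 5 * F 1 r)"
    using profile_laplacian by (simp add: F_def G_def eval_nat_numeral)
  have eq1: "(\<lambda>r. G 0 r + r * G 1 r) = (\<lambda>r. 6 * F 2 r + r * F 3 r)"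
  proof
    fix r
    have "((\<lambda>r. r * G 0 r) has_real_derivative G 0 r + r * G 1 r) (at r)"
      by (auto intro!: derivative_eq_intros dG)
    moreover have "((\<lambda>r. r * F 2 r + 5 * F 1 r) has_real_derivative 6 * F 2 r + r * F 3 r) (at r)"
      by (auto intro!: derivative_eq_intros dF simp: eval_nat_numeral)
    ultimately show "G 0 r + r * G 1 r = 6 * F 2 r + r * F 3 r"
      unfolding eq0 by (rule DERIV_unique)
  qed
  have eq2: "(\<lambda>r. 2 * G 1 r + r * G 2 r) = (\<lambda>r. 7 * F 3 r + r * F 4 r)"
  proof
    fix r
    have "((\<lambda>r. G 0 r + r * G 1 r) has_real_derivative 2 * G 1 r + r * G 2 r) (at r)"
      by (auto intro!: derivative_eq_intros dG simp: eval_nat_numeral)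
    moreover have "((\<lambda>r. 6 * F 2 r + r * F 3 r) has_real_derivative 7 * F 3 r + r * F 4 r) (at r)"
      by (auto intro!: derivative_eq_intros dF simp: eval_nat_numeral)
    ultimately show "2 * G 1 r + r * G 2 r = 7 * F 3 r + r * F 4 r"
      unfolding eq1 by (rule DERIV_unique)
  qed
  \<comment> \<open>The third differentiation is done at 0 only, where the terms with a factor r
    drop out.\<close>
  have "((\<lambda>r. 2 * G 1 r + r * G 2 r) has_real_derivative 3 * G 2 0) (at 0)"
    by (auto intro!: derivative_eq_intros dG simp: eval_nat_numeral)
  moreover have "((\<lambda>r. 7 * F 3 r + r * F 4 r) has_real_derivative 8 * F 4 0) (at 0)"
    by (auto intro!: derivative_eq_intros dF simp: eval_nat_numeral)
  ultimately have "3 * G 2 0 = 8 * F 4 0"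
    unfolding eq2 by (rule DERIV_unique)
  moreover have "profile (laplacian (laplacian f)) 0 = 6 * G 2 0"
    using laplacian_radial_0[OF smooth_laplacian[OF f(1)] radial_laplacian[OF f] axis_1_Basis]
    by (simp add: profile_def G_def eval_nat_numeral)
  ultimately show ?thesis by (simp add: F_def)
qed

end

lemma radial_solution_radial_system:
  assumes "a < 0" "radial_solution a 3 u"
  shows "radial_system a (profile u) (profile (D1 u)) (profile (laplacian u)) (profile (D1 (laplacian u)))
    (profile (laplacian (laplacian u))) (profile (D1 (laplacian (laplacian u))))"
proof -
  have u: "smooth u" "radial u" and eq: "\<And>x. laplacian (laplacian (laplacian u)) x = - exp (6 * u x)"
    using assms(2) by (simp_all add: radial_solution_def eval_nat_numeral)
  have init: "profile u 0 = 0" "profile ((D1 ^^ 2) u) 0 = a" "profile ((D1 ^^ 4) u) 0 = 3"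
    using assms(2) unfolding deriv_profile[OF u(1), symmetric] by (simp_all add: radial_solution_def)
  note u1 = smooth_laplacian[OF u(1)] radial_laplacian[OF u]
  note u2 = smooth_laplacian[OF u1(1)] radial_laplacian[OF u1]
  show ?thesis
    using assms(1) init profile_radial_ode[OF u] profile_radial_ode[OF u1] profile_radial_ode[OF u2]
      profile_laplacian_0[OF u] profile_bilaplacian_0[OF u]
    by unfold_locales (simp_all add: eq profile_def[abs_def])
qed

text \<open>The factor is 6 times the volume pi^3 / 6 of the unit ball, that is, the area of the
  unit sphere.\<close>

lemma nn_integral_exp_radial_solution:
  assumes "smooth u" "radial u"
  shows "(\<integral>\<^sup>+ x. ennreal (exp (6 * u x)) \<partial>lborel) =
    ennreal (pi ^ 3) * (\<integral>\<^sup>+ r. ennreal (r^5 * exp (6 * profile u r)) * indicator {0..} r \<partial>lborel)"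
proof -
  note [measurable] = profile_measurable[OF assms(1)]
  have "u x = profile u (norm x)" for x
    using assms(2)[unfolded radial_def, rule_format, of x "norm x *\<^sub>R axis 1 1"]
    by (simp add: profile_def)
  then have "(\<integral>\<^sup>+ x. ennreal (exp (6 * u x)) \<partial>lborel)
      = (\<integral>\<^sup>+ x. ennreal (exp (6 * profile u (norm (x :: real ^ 6)))) \<partial>lborel)"
    by simp
  also have "\<dots> = (\<integral>\<^sup>+ r. ennreal (6 * unit_ball_vol 6 * r^5) * indicator {0..} r
      * ennreal (exp (6 * profile u r)) \<partial>lborel)"
    by (subst nn_integral_radial) (auto simp: eval_nat_numeral)
  also have "\<dots> = (\<integral>\<^sup>+ r. ennreal (pi ^ 3) *
      (ennreal (r^5 * exp (6 * profile u r)) * indicator {0..} r) \<partial>lborel)"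
    by (intro nn_integral_cong)
      (auto simp: eval_unit_ball_vol ennreal_mult' ennreal_mult mult.assoc split: split_indicator)
  finally show ?thesis
    by (simp add: nn_integral_cmult)
qed

section \<open>Volume and Q-curvature of a solution\<close>

context
  fixes a :: real and u :: "real ^ 6 \<Rightarrow> real"
  assumes a: "a < 0" and u: "radial_solution a 3 u"
begin

interpretation radial_system a "profile u" "profile (D1 u)" "profile (laplacian u)"
  "profile (D1 (laplacian u))" "profile (laplacian (laplacian u))" "profile (D1 (laplacian (laplacian u)))"
  by (rule radial_solution_radial_system[OF a u])

lemma smooth_radial: "smooth u" "radial u"
  using u by (auto simp: radial_solution_def)

lemma density_measurable: "(\<lambda>r. r^5 * exp (6 * profile u r)) \<in> borel_measurable borel"
  using profile_measurable[OF smooth_radial(1)] by measurable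

lemma volume_finite: "(\<integral>\<^sup>+ x. ennreal (exp (6 * u x)) \<partial>lborel) < \<infinity>"
proof -
  obtain K where K: "\<And>r. r \<ge> 0 \<Longrightarrow> mass r \<le> K" using mass_bounded by blast
  have "(\<integral>\<^sup>+ r. ennreal (r^5 * exp (6 * profile u r)) * indicator {0..} r \<partial>lborel) \<le> ennreal K"
    by (rule nn_integral_atLeast_le[OF density_measurable mass_deriv]) (use K mass_0 in auto)
  also have "\<dots> < \<infinity>" by simp
  finally show ?thesis
    by (simp add: nn_integral_exp_radial_solution[OF smooth_radial] ennreal_mult_less_top)
qed

text \<open>The volume is at least that of a ball whose \<open>mass\<close> exceeds 16 a^2; this
  quadratic bound makes the limit infinite.\<close>

lemma volume_lower_bound: "ennreal (16 * pi ^ 3 * a\<^sup>2) \<le> (\<integral>\<^sup>+ x. ennreal (exp (6 * u x)) \<partial>lborel)"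
proof -
  obtain R where R: "R \<ge> 0" "mass R > 16 * a\<^sup>2" using mass_becomes_large by blast
  have "ennreal (16 * a\<^sup>2) \<le> ennreal (mass R)" using R by (intro ennreal_leI) simp
  also have "\<dots> = (\<integral>\<^sup>+ r. ennreal (r^5 * exp (6 * profile u r)) * indicator {0..R} r \<partial>lborel)"
    using nn_integral_FTC_Icc[OF density_measurable mass_deriv, of 0 R] R(1) by (simp add: mass_0)
  also have "\<dots> \<le> (\<integral>\<^sup>+ r. ennreal (r^5 * exp (6 * profile u r)) * indicator {0..} r \<partial>lborel)"
    by (intro nn_integral_mono) (auto split: split_indicator)
  finally have "ennreal (pi ^ 3) * ennreal (16 * a\<^sup>2) \<le> (\<integral>\<^sup>+ x. ennreal (exp (6 * u x)) \<partial>lborel)"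
    unfolding nn_integral_exp_radial_solution[OF smooth_radial] by (rule mult_left_mono) simp
  moreover have "ennreal (pi ^ 3) * ennreal (16 * a\<^sup>2) = ennreal (16 * pi ^ 3 * a\<^sup>2)"
    by (simp add: ennreal_mult[symmetric] mult_ac)
  ultimately show ?thesis by simp
qed

text \<open>Smoothness lets the minus signs pass through the Laplacians; three of them leave one,
  which cancels the sign in the equation.\<close>

lemma Q_curvature_eq_1: "Q_curvature u x = 1"
proof -
  have neg: "neg_laplacian f = (\<lambda>x. - laplacian f x)" for f :: "real ^ 6 \<Rightarrow> real"
    by (simp add: fun_eq_iff neg_laplacian_def)
  have "(neg_laplacian ^^ 3) u = (\<lambda>x. - (laplacian ^^ 3) u x)"
    by (simp add: eval_nat_numeral neg laplacian_minus smooth_laplacian smooth_minus smooth_radial)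
  then have "(neg_laplacian ^^ 3) u x = exp (6 * u x)"
    using u by (simp add: radial_solution_def)
  then show ?thesis
    by (simp add: Q_curvature_def exp_minus)
qed

end

theorem theorem2:
  fixes u :: "real \<Rightarrow> real ^ 6 \<Rightarrow> real"
  assumes "\<And>a. a < 0 \<Longrightarrow> radial_solution a 3 (u a)"
  shows "(\<forall>\<^sub>F a in at_bot. (\<integral>\<^sup>+ x. ennreal (exp (6 * u a x)) \<partial>lborel) < \<infinity>)
       \<and> ((\<lambda>a. \<integral>\<^sup>+ x. ennreal (exp (6 * u a x)) \<partial>lborel) \<longlongrightarrow> \<infinity>) at_bot
       \<and> (\<forall>a<0. \<forall>x. Q_curvature (u a) x = 1)
       \<and> ((\<lambda>a. conformal_volume (u a)) \<longlongrightarrow> \<infinity>) at_bot"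
proof -
  have neg: "\<forall>\<^sub>F a :: real in at_bot. a < 0" by (rule eventually_gt_at_bot)
  have fin: "\<forall>\<^sub>F a in at_bot. (\<integral>\<^sup>+ x. ennreal (exp (6 * u a x)) \<partial>lborel) < \<infinity>"
    using neg by eventually_elim (rule volume_finite[OF _ assms])
  have lim: "((\<lambda>a. \<integral>\<^sup>+ x. ennreal (exp (6 * u a x)) \<partial>lborel) \<longlongrightarrow> \<infinity>) at_bot"
    unfolding infinity_ennreal_def tendsto_top_iff_ennreal
  proof (intro allI impI)
    fix l :: real assume l: "l \<ge> 0"
    \<comment> \<open>This threshold gives both - a > l and - a > 1, the latter for - a <=
      a^2.\<close>
    have "\<forall>\<^sub>F a :: real in at_bot. a < - (1 + l)" by (rule eventually_gt_at_bot)
    then show "\<forall>\<^sub>F a in at_bot. ennreal l < (\<integral>\<^sup>+ x. ennreal (exp (6 * u a x)) \<partial>lborel)"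
    proof eventually_elim
      case (elim a)
      then have "a < 0" using l by simp
      have "l < 1 + l" by simp
      also have "\<dots> < - a" using elim by simp
      also have "- a \<le> (- a)\<^sup>2" using elim l by (intro self_le_power) auto
      also have "\<dots> \<le> 16 * pi ^ 3 * a\<^sup>2"
      proof -
        have "1 \<le> pi ^ 3" using pi_ge_two by (intro one_le_power) linarith
        then show ?thesis using mult_right_mono[of 1 "16 * pi ^ 3" "a\<^sup>2"] by simp
      qed
      finally have "ennreal l < ennreal (16 * pi ^ 3 * a\<^sup>2)" using l by (simp add: ennreal_lessI)
      also have "\<dots> \<le> (\<integral>\<^sup>+ x. ennreal (exp (6 * u a x)) \<partial>lborel)"
        by (rule volume_lower_bound[OF \<open>a < 0\<close> assms[OF \<open>a < 0\<close>]])
      finally show ?case .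
    qed
  qed
  have "\<forall>a<0. \<forall>x. Q_curvature (u a) x = 1"
    using Q_curvature_eq_1 assms by blast
  with fin lim show ?thesis
    by (simp add: conformal_volume_def)
qed

end
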